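(* Let $n\ge 1$ and $m\ge 1$ be integers of the same parity. Then for any partition $\lambda\vdash n+1$ of length $m$, $$\frac{n+1}{2}\sum_{\mu=\lambda^{\downarrow(i+1)},\; i>0} i\, m_i(\mu)\, p^{(n)}_{\mu} = (n-1)!\, z_{\lambda},$$ where the sum runs over all integers $i>0$ with $m_{i+1}(\lambda)\neq 0$, and for each such $i$ one puts $\mu=\lambda^{\downarrow(i+1)}\vdash n$.
   Context: For an integer partition $\lambda$, $m_i(\lambda)$ denotes the number of parts of $\lambda$ equal to $i$, so one writes $\lambda=1^{m_1}2^{m_2}\cdots$; the length $\ell(\lambda)$ is the number of positive parts; $\lambda\vdash N$ means $\lambda$ is a partition of $N$. The cycle-type of a permutation in $\mathfrak{S}_N$ is the partition of $N$ formed by its cycle lengths. For $\lambda\vdash N$, $z_\lambda$ denotes the number of permutations in $\mathfrak{S}_N$ of cycle-type $\lambda$, i.e. $z_\lambda=\frac{N!}{\prod_i i^{m_i}m_i!}$ (note that this is the size of the conjugacy class, not of the centralizer). For $\lambda\vdash n+1$ and $i>0$ with $m_{i+1}(\lambda)\neq 0$, $\lambda^{\downarrow(i+1)}$ denotes the partition of $n$ obtained from $\lambda$ by replacing one part equal to $i+1$ with a part equal to $i$ (so $m_i$ increases by $1$ and $m_{i+1}$ decreases by $1$). For $\mu\vdash n$, $p^{(n)}_\mu$ denotes the number of ordered pairs of $n$-cycles in $\mathfrak{S}_n$ whose product has cycle-type $\mu$. *)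

theory Defs
  imports Complex_Main "HOL-Library.Multiset" "HOL-Combinatorics.Orbits"
begin

text \<open>An integer partition is the multiset of its (positive) parts: the multiplicity of \<open>i\<close> in
  \<open>lam\<close> is \<open>count lam i\<close> and the length is \<open>size lam\<close>.\<close>

definition partition_of :: "nat \<Rightarrow> nat multiset \<Rightarrow> bool" where
  "partition_of N lam \<longleftrightarrow> 0 \<notin># lam \<and> sum_mset lam = N"

text \<open>The orbits form a set, so each cycle of \<open>f\<close> (fixed points included) contributes exactly one
  part.  This is meant for \<open>f permutes S\<close> with \<open>S\<close> finite.\<close>

definition cycle_type :: "'a set \<Rightarrow> ('a \<Rightarrow> 'a) \<Rightarrow> nat multiset" where
  "cycle_type S f = image_mset card (mset_set (orbit f ` S))"

text \<open>The size of the conjugacy class of cycle-type \<open>lam\<close>, not of the centralizer of one of its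
  elements.\<close>

definition z_num :: "nat multiset \<Rightarrow> nat" where
  "z_num lam = card {f. f permutes {1..sum_mset lam} \<and> cycle_type {1..sum_mset lam} f = lam}"

definition full_cycles :: "nat \<Rightarrow> (nat \<Rightarrow> nat) set" where
  "full_cycles n = {f. f permutes {1..n} \<and> cyclic_on f {1..n}}"

definition p_num :: "nat \<Rightarrow> nat multiset \<Rightarrow> nat" where
  "p_num n mu = card {(f, g). f \<in> full_cycles n \<and> g \<in> full_cycles n \<and>
                          cycle_type {1..n} (f \<circ> g) = mu}"

text \<open>The first argument is the part that is decreased: \<open>lower_part (i + 1) lam\<close> replaces one part
  \<open>i + 1\<close> of \<open>lam\<close> by \<open>i\<close>.  Only meaningful when that part occurs in \<open>lam\<close> and \<open>i > 0\<close>.\<close>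

definition lower_part :: "nat \<Rightarrow> nat multiset \<Rightarrow> nat multiset" where
  "lower_part j lam = add_mset (j - 1) (lam - {#j#})"

end

theory Submission
  imports Defs
begin

text \<open>
  Put \<open>N = n + 1\<close>.  The left-hand sum counts triples \<open>(f, g, x)\<close> in which \<open>f\<close> and \<open>g\<close> are
  \<open>n\<close>-cycles, \<open>x\<close> is a point, and inserting \<open>N\<close> after \<open>x\<close> into the cycle of \<open>f \<circ> g\<close> through \<open>x\<close> makes a
  permutation of type \<open>lam\<close>.  Inserting \<open>N\<close> after \<open>x\<close> into \<open>g\<close> itself yields every
  \<open>N\<close>-cycle exactly once.  Hence the sum is the number of pairs of an \<open>n\<close>-cycle missing \<open>N\<close> and an \<open>N\<close>-cycle
  with product of type \<open>lam\<close> (\<open>sum_lower_parts\<close>).  By conjugation any other missed point gives the same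
  number, so \<open>N\<close> times it counts all pairs of a cycle missing one point and an \<open>N\<close>-cycle
  whose product has type \<open>lam\<close> (\<open>factorization_count_indep\<close>, \<open>sum_factorization_count\<close>).

  Since \<open>n\<close> and the length of \<open>lam\<close> have the same parity, permutations of type \<open>lam\<close> are odd
  (\<open>evenperm_iff_cycle_type\<close>), and the theorem follows from a fact about a single odd permutation
  of \<open>N \<ge> 2\<close> points: it is such a product in exactly \<open>2 * (N - 2)!\<close> ways, whatever
  its type (\<open>count_factorizations_of_odd\<close>).  This is proved by induction on \<open>N\<close>: removing a point
  that is not fixed expresses the number for \<open>w\<close> through the numbers for \<open>N - 2\<close> odd permutations of
  \<open>N - 1\<close> points, plus and minus the same number of factorizations of an even permutation into two
  full cycles.  The latter depends on the cycle type, but it cancels.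
\<close>

section \<open>Inserting a point into a cycle\<close>

text \<open>Right multiplication of \<open>v\<close> by \<open>exchange d p\<close>, where \<open>v\<close> fixes \<open>p\<close>, inserts \<open>p\<close> into the
  cycle of \<open>v\<close> through \<open>d\<close>, immediately after \<open>d\<close>: the product sends \<open>d\<close> to \<open>p\<close> and \<open>p\<close> to \<open>v d\<close>.
  This is the operation on which everything below rests.  The abbreviation separates the
  transposition of two points from the transposition of a list of lists.\<close>
abbreviation exchange :: "'a \<Rightarrow> 'a \<Rightarrow> 'a \<Rightarrow> 'a" where
  "exchange \<equiv> Transposition.transpose"

definition cycles_on :: "'a set \<Rightarrow> ('a \<Rightarrow> 'a) set" where
  "cycles_on S = {f. f permutes S \<and> cyclic_on f S}"

lemma cycles_onD: "f \<in> cycles_on S \<Longrightarrow> f permutes S"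
  by (simp add: cycles_on_def)

lemma finite_cycles_on: "finite S \<Longrightarrow> finite (cycles_on S)"
  unfolding cycles_on_def by (rule finite_subset[OF _ finite_permutations]) auto

lemma cycles_on_iff_orbit:
  assumes "f permutes S" "finite S" "x \<in> S"
  shows "f \<in> cycles_on S \<longleftrightarrow> orbit f x = S"
  using assms orbit_cyclic_eq3[of f S x] cyclic_on_singleI[of x S f]
  by (auto simp: cycles_on_def)

lemma orbit_insert_point:
  assumes v: "v permutes S" and fin: "finite S" and p: "p \<notin> S" and d: "d \<in> S" and x: "x \<in> S"
  shows "orbit (v \<circ> exchange d p) x = (if d \<in> orbit v x then insert p (orbit v x) else orbit v x)"
proof -
  let ?u = "v \<circ> exchange d p"
  have perm: "permutation v" using v fin permutation_permutes by blast
  have ud: "?u d = p" using v p by (simp add: permutes_not_in)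
  have up: "?u p = v d" by simp
  have uud: "?u (?u d) = v d" using ud up by simp
  have uo: "?u y = v y" if "y \<in> S" "y \<noteq> d" for y using that p by (auto simp: transpose_def)
  have sub: "orbit v x \<subseteq> S" using permutes_orbit_subset[OF v x] .
  have self: "x \<in> orbit v x" using permutation_self_in_orbit[OF perm] .
  have 1: "y \<in> orbit v x \<or> y = p \<and> d \<in> orbit v x" if "y \<in> orbit ?u x" for y
    using that
  proof induct
    case base
    show ?case using ud uo[OF x] self orbit.base[of v x] by (cases "x = d") auto
  next
    case (step y)
    from step(2) show ?case
    proof
      assume y: "y \<in> orbit v x"
      show ?thesis
      proof (cases "y = d")
        case True then show ?thesis using ud y by simp
      next
        case False then show ?thesis using uo[of y] y sub orbit.step[OF y] by auto
      qed
    next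
      assume "y = p \<and> d \<in> orbit v x"
      then show ?thesis using up orbit.step[of d v x] by simp
    qed
  qed
  have 2: "y \<in> orbit ?u x" if "y \<in> orbit v x" for y
    using that
  proof induct
    case base
    show ?case
    proof (cases "x = d")
      case True
      show ?thesis using orbit.step[OF orbit.base[of ?u x]] True uud by metis
    next
      case False
      then show ?thesis using uo[OF x] orbit.base[of ?u x] by metis
    qed
  next
    case (step y)
    have "y \<in> S" using step sub by auto
    show ?case
    proof (cases "y = d")
      case True
      show ?thesis using orbit.step[OF orbit.step[OF step(2)]] True uud by metis
    next
      case False
      then show ?thesis using uo[OF \<open>y \<in> S\<close>] orbit.step[OF step(2)] by metis
    qed
  qed
  have 3: "p \<in> orbit ?u x" if "d \<in> orbit v x"
    using orbit.step[OF 2[OF that]] ud by simp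
  show ?thesis
  proof (cases "d \<in> orbit v x")
    case True
    then have "orbit ?u x = insert p (orbit v x)" using 1 2 3 by blast
    then show ?thesis using True by simp
  next
    case False
    then have "orbit ?u x = orbit v x" using 1 2 by blast
    then show ?thesis using False by simp
  qed
qed

lemma insert_point_permutes:
  assumes "v permutes S" "d \<in> S"
  shows "v \<circ> exchange d p permutes insert p S"
  using assms by (intro permutes_compose permutes_swap_id permutes_imp_permutes_insert) auto

lemma orbit_of_inserted_point:
  assumes v: "v permutes S" and fin: "finite S" and p: "p \<notin> S" and d: "d \<in> S"
  shows "orbit (v \<circ> exchange d p) p = insert p (orbit v d)"
proof -
  let ?u = "v \<circ> exchange d p"
  have perm: "permutation v" using v fin permutation_permutes by blast
  have perm': "permutation ?u"
    using insert_point_permutes[OF v d] fin permutation_permutes by (metis finite_insert)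
  have "orbit ?u p = orbit ?u d"
    using permutation_orbit_step[OF perm', of d] v p by (simp add: permutes_not_in)
  also have "\<dots> = insert p (orbit v d)"
    using orbit_insert_point[OF v fin p d d] permutation_self_in_orbit[OF perm] by simp
  finally show ?thesis .
qed

text \<open>Insertion of a point never changes the number of cycles, so it preserves and reflects
  being one full cycle.\<close>
lemma insert_point_in_cycles_on_iff:
  assumes v: "v permutes S" and fin: "finite S" and p: "p \<notin> S" and d: "d \<in> S"
  shows "v \<circ> exchange d p \<in> cycles_on (insert p S) \<longleftrightarrow> v \<in> cycles_on S"
proof -
  have "v \<circ> exchange d p \<in> cycles_on (insert p S) \<longleftrightarrow> insert p (orbit v d) = insert p S"
    using cycles_on_iff_orbit[OF insert_point_permutes[OF v d], of p p]
      orbit_of_inserted_point[OF v fin p d] fin by simp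
  also have "\<dots> \<longleftrightarrow> orbit v d = S"
    using permutes_orbit_subset[OF v d] p by (intro insert_ident) auto
  finally show ?thesis using cycles_on_iff_orbit[OF v fin d] by simp
qed

lemma cycle_type_insert_point:
  assumes v: "v permutes S" and fin: "finite S" and p: "p \<notin> S" and d: "d \<in> S"
  shows "cycle_type (insert p S) (v \<circ> exchange d p) =
    add_mset (card (orbit v d) + 1) (cycle_type S v - {#card (orbit v d)#})"
proof -
  let ?u = "v \<circ> exchange d p" and ?O = "orbit v d"
  have perm: "permutation v" using v fin permutation_permutes by blast
  have self: "x \<in> orbit v x" for x using permutation_self_in_orbit[OF perm] .
  have eq: "orbit v x = ?O" if "d \<in> orbit v x" for x
    using orbit_cyclic_eq3[OF cyclic_on_orbit[OF v fin] that] by simp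
  have sub: "orbit v x \<subseteq> S" if "x \<in> S" for x using permutes_orbit_subset[OF v that] .
  have "orbit ?u x = (if orbit v x = ?O then insert p ?O else orbit v x)" if "x \<in> S" for x
  proof (cases "d \<in> orbit v x")
    case True
    then show ?thesis using orbit_insert_point[OF v fin p d that] eq[OF True] by simp
  next
    case False
    then have "orbit v x \<noteq> ?O" using self[of d] by metis
    then show ?thesis using orbit_insert_point[OF v fin p d that] False by simp
  qed
  then have img: "orbit ?u ` insert p S = insert (insert p ?O) (orbit v ` S - {?O})"
    using orbit_of_inserted_point[OF v fin p d] d by auto
  have notin: "insert p ?O \<notin> orbit v ` S - {?O}" using sub p by blast
  have in': "?O \<in># mset_set (orbit v ` S)" using d fin by simp
  have "cycle_type (insert p S) ?u = add_mset (card (insert p ?O))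
      (image_mset card (mset_set (orbit v ` S - {?O})))"
    unfolding cycle_type_def img using notin fin by simp
  also have "mset_set (orbit v ` S - {?O}) = mset_set (orbit v ` S) - {#?O#}"
    using mset_set_Diff[of "orbit v ` S" "{?O}"] fin d by simp
  also have "image_mset card \<dots> = cycle_type S v - {#card ?O#}"
    unfolding cycle_type_def using in' by (simp add: image_mset_Diff)
  also have "card (insert p ?O) = card ?O + 1"
    using sub[OF d] p fin by (subst card_insert_disjoint) (auto intro: finite_subset)
  finally show ?thesis .
qed

lemma cycle_type_insert_fixed_point:
  assumes v: "v permutes S" and fin: "finite S" and p: "p \<notin> S"
  shows "cycle_type (insert p S) v = add_mset 1 (cycle_type S v)"
proof -
  have "orbit v p = {p}" using v p by (simp add: orbit_eq_singleton_iff permutes_not_in)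
  moreover have "{p} \<notin> orbit v ` S"
    using permutes_orbit_subset[OF v] p by blast
  ultimately show ?thesis using fin by (simp add: cycle_type_def)
qed

lemma card_orbit_in_cycle_type:
  "finite S \<Longrightarrow> x \<in> S \<Longrightarrow> card (orbit f x) \<in># cycle_type S f"
  by (auto simp: cycle_type_def)

lemma permutes_insert_point_decomp:
  assumes u: "u permutes insert p S" and p: "p \<notin> S" and ne: "u p \<noteq> p"
  defines "d \<equiv> inv u p"
  shows "d \<in> S" "u \<circ> exchange d p permutes S" "u = (u \<circ> exchange d p) \<circ> exchange d p"
proof -
  have ud: "u d = p" unfolding d_def using permutes_inverses(1)[OF u] .
  have "d \<noteq> p" using ud ne by auto
  moreover have "d \<in> insert p S" using ud permutes_in_image[OF u, of d] by simp
  ultimately show d: "d \<in> S" by simp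
  show "u \<circ> exchange d p permutes S"
  proof (rule permutes_superset)
    show "u \<circ> exchange d p permutes insert p S"
      using u d by (intro permutes_compose permutes_swap_id) auto
  qed (use ud in auto)
  show "u = (u \<circ> exchange d p) \<circ> exchange d p" by (simp add: comp_assoc)
qed

section \<open>Parity and conjugacy\<close>

lemma evenperm_insert_point:
  assumes v: "v permutes S" and fin: "finite S" and "d \<noteq> p"
  shows "evenperm (v \<circ> exchange d p) \<longleftrightarrow> \<not> evenperm v"
proof -
  have perm: "permutation v" using v fin permutation_permutes by blast
  show ?thesis using assms by (simp add: evenperm_comp[OF perm permutation_swap_id] evenperm_swap)
qed

text \<open>Building \<open>f\<close> up point by point, a new fixed point adds one to both the number of points
  and the number of cycles, while an insertion adds one point, no cycle, and one transposition.\<close>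
lemma evenperm_iff_cycle_type:
  assumes "finite S" "f permutes S"
  shows "evenperm f \<longleftrightarrow> even (card S + size (cycle_type S f))"
  using assms
proof (induction S arbitrary: f)
  case empty
  then show ?case by (simp add: cycle_type_def)
next
  case (insert p S)
  show ?case
  proof (cases "f p = p")
    case True
    then have f: "f permutes S"
      using permutes_superset[OF insert.prems, of S] by auto
    show ?thesis
      using insert.IH[OF f] cycle_type_insert_fixed_point[OF f insert.hyps] insert.hyps by simp
  next
    case False
    define d v where "d = inv f p" and "v = f \<circ> exchange d p"
    have d: "d \<in> S" and v: "v permutes S" and f: "f = v \<circ> exchange d p"
      using permutes_insert_point_decomp[OF insert.prems insert.hyps(2) False]
      unfolding d_def v_def by auto
    have "size (cycle_type S v - {#card (orbit v d)#}) + 1 = size (cycle_type S v)"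
      using card_orbit_in_cycle_type[OF insert.hyps(1) d, of v]
      by (metis Suc_eq_plus1 insert_DiffM size_add_mset)
    then have "size (cycle_type (insert p S) f) = size (cycle_type S v)"
      unfolding f cycle_type_insert_point[OF v insert.hyps d] by simp
    moreover have "evenperm f \<longleftrightarrow> \<not> evenperm v"
      unfolding f using evenperm_insert_point[OF v insert.hyps(1), of d p] d insert.hyps(2) by auto
    ultimately show ?thesis using insert.IH[OF v] insert.hyps by simp
  qed
qed

lemma cycle_type_conj:
  assumes h: "h permutes S" and fin: "finite S" and f: "f permutes S"
  shows "cycle_type S (h \<circ> f \<circ> inv h) = cycle_type S f"
proof -
  have perm: "permutation f" using f fin permutation_permutes by blast
  have orb: "orbit (h \<circ> f \<circ> inv h) (h x) = h ` orbit f x" for x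
    by (rule orbit_inverse[symmetric])
      (simp_all add: permutation_self_in_orbit[OF perm] permutes_inverses[OF h])
  have "orbit (h \<circ> f \<circ> inv h) ` S = orbit (h \<circ> f \<circ> inv h) ` h ` S"
    using permutes_image[OF h] by simp
  also have "\<dots> = (\<lambda>X. h ` X) ` orbit f ` S" using orb by (simp add: image_image)
  finally have *: "orbit (h \<circ> f \<circ> inv h) ` S = (\<lambda>X. h ` X) ` orbit f ` S" .
  have "inj ((`) h)" using permutes_inj[OF h] by (simp add: inj_image_eq_iff inj_on_def)
  then have inj: "inj_on ((`) h) (orbit f ` S)" by (rule inj_on_subset) simp
  have "cycle_type S (h \<circ> f \<circ> inv h) = image_mset card (image_mset ((`) h) (mset_set (orbit f ` S)))"
    unfolding cycle_type_def * image_mset_mset_set[OF inj] ..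
  also have "\<dots> = image_mset card (mset_set (orbit f ` S))"
    using permutes_inj_on[OF h] by (auto simp: image_mset.compositionality intro!: image_mset_cong card_image)
  finally show ?thesis by (simp add: cycle_type_def)
qed

section \<open>Factorizations of an odd permutation\<close>

lemma cycles_on_no_fixed_point:
  assumes "u \<in> cycles_on T" "2 \<le> card T" "x \<in> T"
  shows "u x \<noteq> x"
proof
  assume "u x = x"
  then have "T = {x}"
    using assms orbit_cyclic_eq3[of u T x] orbit_eq_singleton_iff[of u x]
    by (simp add: cycles_on_def)
  then show False using assms(2) by simp
qed

text \<open>A full cycle on \<open>insert p S\<close> arises from exactly one full cycle on \<open>S\<close> by inserting \<open>p\<close>
  after exactly one point, namely after its predecessor.  With \<open>S = {}\<close> this would fail, since
  the identity on \<open>{p}\<close> is a full cycle without being an insertion.\<close>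
lemma bij_betw_insert_point:
  assumes fin: "finite S" and p: "p \<notin> S" and ne: "S \<noteq> {}"
  shows "bij_betw (\<lambda>(c, e). c \<circ> exchange e p) (cycles_on S \<times> S) (cycles_on (insert p S))"
proof (rule bij_betw_byWitness[where f' = "\<lambda>u. (u \<circ> exchange (inv u p) p, inv u p)"])
  have "inv (c \<circ> exchange e p) p = e" if "c \<in> cycles_on S" "e \<in> S" for c e
  proof -
    note c = cycles_onD[OF that(1)]
    have "(c \<circ> exchange e p) e = p" using c p by (simp add: permutes_not_in)
    then show ?thesis
      using permutes_inv_eq[OF insert_point_permutes[OF c that(2)]] by blast
  qed
  then show "\<forall>x\<in>cycles_on S \<times> S. (\<lambda>u. (u \<circ> exchange (inv u p) p, inv u p))
      ((\<lambda>(c, e). c \<circ> exchange e p) x) = x"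
    by (auto simp: comp_assoc)
  show "\<forall>u\<in>cycles_on (insert p S). (\<lambda>(c, e). c \<circ> exchange e p)
      (u \<circ> exchange (inv u p) p, inv u p) = u"
    by (simp add: comp_assoc)
  show "(\<lambda>(c, e). c \<circ> exchange e p) ` (cycles_on S \<times> S) \<subseteq> cycles_on (insert p S)"
    using insert_point_in_cycles_on_iff[OF _ fin p] cycles_onD by auto
  have "2 \<le> card (insert p S)" using fin p ne by (simp add: Suc_le_eq card_gt_0_iff)
  then have "u \<circ> exchange (inv u p) p \<in> cycles_on S \<and> inv u p \<in> S"
    if u: "u \<in> cycles_on (insert p S)" for u
    using permutes_insert_point_decomp[OF cycles_onD[OF u] p] u
      cycles_on_no_fixed_point[OF u] insert_point_in_cycles_on_iff[OF _ fin p]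
    by (metis insertI1)
  then show "(\<lambda>u. (u \<circ> exchange (inv u p) p, inv u p)) ` cycles_on (insert p S) \<subseteq> cycles_on S \<times> S"
    by auto
qed

lemma sum_cycles_on_insert:
  assumes "finite S" "p \<notin> S" "S \<noteq> {}"
  shows "(\<Sum>u\<in>cycles_on (insert p S). F u) = (\<Sum>c\<in>cycles_on S. \<Sum>e\<in>S. F (c \<circ> exchange e p))"
  using sum.reindex_bij_betw[OF bij_betw_insert_point[OF assms], of F]
  by (simp add: sum.cartesian_product case_prod_unfold)

lemma cycles_on_singleton: "cycles_on {z} = {id}"
proof -
  have "orbit id z = {z}" by (simp add: orbit_eq_singleton_iff)
  then show ?thesis by (auto simp: cycles_on_def cyclic_on_def)
qed

text \<open>The heart of the induction.  The product of the two transpositions is also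
  \<open>exchange b d \<circ> exchange d p\<close>, so the permutation in question is \<open>v \<circ> exchange b d\<close> with \<open>p\<close>
  inserted after \<open>d\<close>.  It fixes neither \<open>p\<close> nor \<open>d\<close>, and for \<open>a \<noteq> d\<close> the insertion
  does not affect whether everything except \<open>a\<close> forms a single cycle.  The two sides therefore
  differ exactly by the term \<open>a = d\<close> on the right, where \<open>d\<close> is a fixed point of \<open>v \<circ> exchange b d\<close>
  and the rest is one cycle.  Multiplying by \<open>exchange b d\<close> once more inserts \<open>d\<close> after \<open>b\<close>,
  so this term says that \<open>v\<close> is a full cycle sending \<open>b\<close> to \<open>d\<close>.\<close>
lemma count_insert_point:
  assumes fin: "finite S" and p: "p \<notin> S" and b: "b \<in> S" and d: "d \<in> S" "d \<noteq> b"
    and v: "v permutes S"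
  shows "(\<Sum>a\<in>insert p S. of_bool (v \<circ> exchange d p \<circ> exchange p b \<in> cycles_on (insert p S - {a})))
      + of_bool (v \<in> cycles_on S \<and> v b = d)
    = (\<Sum>a\<in>S. of_bool (v \<circ> exchange b d \<in> cycles_on (S - {a})) :: nat)"
proof -
  define v' where "v' = v \<circ> exchange b d"
  define u where "u = v \<circ> exchange d p \<circ> exchange p b"
  have v': "v' permutes S" unfolding v'_def using v b d by (intro permutes_compose permutes_swap_id)
  have u: "u = v' \<circ> exchange d p"
    unfolding u_def v'_def using p b d by (auto simp: fun_eq_iff transpose_def)
  have ud: "u d = p" unfolding u using v' p by (simp add: permutes_not_in)
  have up: "u p \<noteq> p" unfolding u using permutes_in_image[OF v', of d] d p by auto
  have "u \<notin> cycles_on (insert p S - {p})"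
    using up cycles_onD[of u "insert p S - {p}"] permutes_not_in[of u _ p] by blast
  moreover have "u \<in> cycles_on (insert p S - {a}) \<longleftrightarrow> a \<noteq> d \<and> v' \<in> cycles_on (S - {a})"
    if a: "a \<in> S" for a
  proof -
    have eq: "insert p S - {a} = insert p (S - {a})" using a p by auto
    show ?thesis
    proof (cases "a \<noteq> d \<and> v' a = a")
      case True
      then have "v' permutes S - {a}" by (intro permutes_superset[OF v']) auto
      moreover have "d \<in> S - {a}" using d True by auto
      ultimately have "v' \<circ> exchange d p \<in> cycles_on (insert p (S - {a})) \<longleftrightarrow> v' \<in> cycles_on (S - {a})"
        using fin p by (intro insert_point_in_cycles_on_iff) auto
      then show ?thesis using True unfolding eq u by blast
    next
      case False
      have "a \<noteq> p" using a p by blast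
      then have "u a \<noteq> a"
        using False ud p a by (cases "a = d") (auto simp: u)
      then have "u \<notin> cycles_on (insert p S - {a})"
        using cycles_onD[of u "insert p S - {a}"] permutes_not_in[of u _ a] by blast
      moreover have "v' a \<noteq> a \<Longrightarrow> v' \<notin> cycles_on (S - {a})"
        using cycles_onD[of v' "S - {a}"] permutes_not_in[of v' _ a] by blast
      ultimately show ?thesis using False by blast
    qed
  qed
  ultimately have "(\<Sum>a\<in>insert p S. of_bool (u \<in> cycles_on (insert p S - {a})))
      = of_bool False + (\<Sum>a\<in>S. of_bool (a \<noteq> d \<and> v' \<in> cycles_on (S - {a})) :: nat)"
    unfolding sum.insert[OF fin p] by (intro arg_cong2[of _ _ _ _ "(+)"] sum.cong) auto
  also have "\<dots> = (\<Sum>a\<in>S. of_bool (a \<noteq> d \<and> v' \<in> cycles_on (S - {a})))" by simp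
  also have "\<dots> = (\<Sum>a\<in>S - {d}. of_bool (v' \<in> cycles_on (S - {a})))"
    using fin d by (intro sum.mono_neutral_cong_right) auto
  finally have 1: "(\<Sum>a\<in>insert p S. of_bool (u \<in> cycles_on (insert p S - {a})))
      = (\<Sum>a\<in>S - {d}. of_bool (v' \<in> cycles_on (S - {a})) :: nat)" .
  \<comment> \<open>the excluded term, recovered by inserting the fixed point d back after b\<close>
  have 2: "v \<in> cycles_on S \<and> v b = d \<longleftrightarrow> v' \<in> cycles_on (S - {d})"
  proof (cases "v b = d")
    case True
    then have "v' d = d" by (simp add: v'_def)
    then have "v' permutes S - {d}" by (intro permutes_superset[OF v']) auto
    moreover have "v = v' \<circ> exchange b d" by (simp add: v'_def comp_assoc)
    moreover have "insert d (S - {d}) = S" using d by auto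
    ultimately show ?thesis
      using insert_point_in_cycles_on_iff[of v' "S - {d}" d b] True b d fin by simp
  next
    case False
    then have "v' d \<noteq> d" by (simp add: v'_def)
    then have "v' \<notin> cycles_on (S - {d})"
      using cycles_onD[of v' "S - {d}"] permutes_not_in[of v' _ d] by blast
    then show ?thesis using False by simp
  qed
  show ?thesis
    using 1 2 sum.remove[OF fin d(1), of "\<lambda>a. of_bool (v' \<in> cycles_on (S - {a})) :: nat"]
    by (simp flip: u_def v'_def)
qed

text \<open>An odd permutation is a product of a full cycle and a permutation with one fixed point
  and one other cycle in a number of ways that depends only on the degree.  In the induction, write
  \<open>w = w0 \<circ> exchange p b\<close> with \<open>w0\<close> fixing \<open>p\<close>, and write a full cycle on \<open>S\<close> as a full cycle \<open>c\<close>
  on \<open>T = S - {p}\<close> with \<open>p\<close> inserted after \<open>w0 d\<close>.  The product to be tested becomes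
  \<open>c \<circ> w0 \<circ> exchange d p \<circ> exchange p b\<close>.  The choice \<open>d = b\<close> contributes the number \<open>B\<close> of full
  cycles \<open>c\<close> for which \<open>c \<circ> w0\<close> is a full cycle.  The other choices contribute, by
  \<open>count_insert_point\<close>, the counts of the odd permutations \<open>w0 \<circ> exchange b d\<close> of degree one less,
  minus a correction which, summed over \<open>d\<close>, is \<open>B\<close> again.  The unknown \<open>B\<close> cancels, and
  \<open>n - 1\<close> equal counts of degree \<open>n\<close> remain.

  Degree 2 has to be the base: there both points are fixed by the product, so each of them
  counts, whereas in larger degree the choice \<open>d = b\<close> can only yield the fixed point \<open>p\<close>.\<close>
lemma count_factorizations_of_odd:
  assumes "finite S" "2 \<le> card S" "w permutes S" "\<not> evenperm w"
  shows "(\<Sum>c\<in>cycles_on S. \<Sum>a\<in>S. of_bool (c \<circ> w \<in> cycles_on (S - {a})))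
    = (2 * fact (card S - 2) :: nat)"
  using assms(2,1,3,4)
proof (induction "card S" arbitrary: S w rule: nat_induct_at_least)
  case base
  then obtain x y where S: "S = {x, y}" and xy: "x \<noteq> y" by (metis card_2_iff)
  have w: "w = exchange x y"
    using base S permutes_doubleton_iff[of w x y] by auto
  have "cycles_on S = {exchange x y}"
  proof -
    have "u = exchange x y" if "u \<in> cycles_on S" for u
      using cycles_onD[OF that] cycles_on_no_fixed_point[OF that, of x] base(1) S
        permutes_doubleton_iff[of u x y] by auto
    moreover have "exchange x y \<in> cycles_on S"
      using insert_point_in_cycles_on_iff[of id "{x}" y x] xy
      by (simp add: S cycles_on_singleton insert_commute)
    ultimately show ?thesis by blast
  qed
  moreover have "id \<in> cycles_on (S - {a})" if "a \<in> S" for a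
  proof -
    have "S - {x} = {y}" "S - {y} = {x}" using S xy by auto
    moreover have "a = x \<or> a = y" using that S by simp
    ultimately show ?thesis using cycles_on_singleton by (metis insertI1)
  qed
  ultimately show ?case using base(1) by (simp add: w id_def)
next
  case (Suc n)
  have "w \<noteq> id" using Suc.prems by auto
  then obtain p where wp: "w p \<noteq> p" by (auto simp: fun_eq_iff)
  then have "p \<in> S" using Suc.prems permutes_not_in by metis
  define T where "T = S - {p}"
  have S: "S = insert p T" and p: "p \<notin> T" using \<open>p \<in> S\<close> by (auto simp: T_def)
  have fin: "finite T" using Suc.prems by (simp add: T_def)
  have cT: "card T = n" using Suc.hyps(3) S p fin by simp
  have wT: "w permutes insert p T" using Suc.prems S by simp
  define b w0 where "b = inv w p" and "w0 = w \<circ> exchange b p"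
  have b: "b \<in> T" and w0: "w0 permutes T" and w: "w = w0 \<circ> exchange p b"
    using permutes_insert_point_decomp[OF wT p wp]
    by (simp_all add: b_def w0_def transpose_commute)
  have ev: "evenperm w0"
    using evenperm_insert_point[OF w0 fin, of b p] b p Suc.prems w by (auto simp: transpose_commute)
  have odd: "\<not> evenperm (w0 \<circ> exchange b d)" if "d \<noteq> b" for d
    using evenperm_insert_point[OF w0 fin, of b d] that ev by auto
  have v: "c \<circ> w0 permutes T" if "c \<in> cycles_on T" for c
    using w0 cycles_onD[OF that] by (rule permutes_compose)
  define F where "F v d = (\<Sum>a\<in>S. of_bool (v \<circ> exchange d p \<circ> exchange p b \<in> cycles_on (S - {a})) :: nat)" for v d
  define B where "B = (\<Sum>c\<in>cycles_on T. of_bool (c \<circ> w0 \<in> cycles_on T) :: nat)"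
  \<comment> \<open>the point d is reparametrized by w0 so that the transposition can be moved past w0\<close>
  have comp: "c \<circ> exchange (w0 d) p \<circ> w = (c \<circ> w0) \<circ> exchange d p \<circ> exchange p b"
    if "d \<in> T" for c d
  proof -
    have "exchange (w0 d) p \<circ> w0 = w0 \<circ> exchange d p"
      using transpose_comp_eq[OF permutes_bij[OF w0], of "w0 d" p] permutes_inverses(2)[OF w0]
        permutes_not_in[OF permutes_inv[OF w0] p] by simp
    then show ?thesis unfolding w by (metis comp_assoc)
  qed
  have "(\<Sum>c\<in>cycles_on S. \<Sum>a\<in>S. of_bool (c \<circ> w \<in> cycles_on (S - {a})))
      = (\<Sum>c\<in>cycles_on T. \<Sum>e\<in>T. \<Sum>a\<in>S. of_bool (c \<circ> exchange e p \<circ> w \<in> cycles_on (S - {a})) :: nat)"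
    using sum_cycles_on_insert[OF fin p] b S by blast
  also have "\<dots> = (\<Sum>c\<in>cycles_on T. \<Sum>d\<in>T. F (c \<circ> w0) d)"
    by (subst sum.permute[OF w0]) (simp add: comp F_def)
  also have "\<dots> = (\<Sum>c\<in>cycles_on T. F (c \<circ> w0) b) + (\<Sum>c\<in>cycles_on T. \<Sum>d\<in>T - {b}. F (c \<circ> w0) d)"
    using fin b by (simp add: sum.remove[of T b] sum.distrib)
  also have "(\<Sum>c\<in>cycles_on T. F (c \<circ> w0) b) = B"
    unfolding B_def
  proof (rule sum.cong[OF refl])
    fix c assume "c \<in> cycles_on T"
    note v = v[OF this]
    have "(c \<circ> w0) p = p" using permutes_not_in[OF v p] .
    \<comment> \<open>a cycle on at least two points, one of which is p, would have to move p\<close>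
    then have "c \<circ> w0 \<notin> cycles_on (S - {a})" if "a \<in> T" for a
      using cycles_on_no_fixed_point[of "c \<circ> w0" "S - {a}" p] that p \<open>p \<in> S\<close>
        Suc.hyps(1,3) card_Diff_singleton[of a S] S by (metis DiffI diff_Suc_1 insertI2 singletonD)
    moreover have "c \<circ> w0 \<circ> exchange b p \<circ> exchange p b = c \<circ> w0"
      by (simp add: comp_assoc transpose_commute)
    moreover have "S - {p} = T" by (simp add: T_def)
    ultimately show "F (c \<circ> w0) b = of_bool (c \<circ> w0 \<in> cycles_on T)"
      unfolding F_def using fin p by (auto simp: S)
  qed
  also have "B = (\<Sum>c\<in>cycles_on T. \<Sum>d\<in>T - {b}. of_bool (c \<circ> w0 \<in> cycles_on T \<and> (c \<circ> w0) b = d))"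
    unfolding B_def
  proof (rule sum.cong[OF refl])
    fix c assume "c \<in> cycles_on T"
    note v = v[OF this]
    \<comment> \<open>a full cycle on at least two points sends b to exactly one d, different from b\<close>
    have "(c \<circ> w0) b \<in> T - {b}" if "c \<circ> w0 \<in> cycles_on T"
      using cycles_on_no_fixed_point[OF that, of b] b cT Suc.hyps(1) permutes_in_image[OF v, of b] by auto
    then show "of_bool (c \<circ> w0 \<in> cycles_on T)
      = (\<Sum>d\<in>T - {b}. of_bool (c \<circ> w0 \<in> cycles_on T \<and> (c \<circ> w0) b = d) :: nat)"
      using fin by (cases "c \<circ> w0 \<in> cycles_on T") (auto simp: of_bool_def)
  qed
  also have "\<dots> + (\<Sum>c\<in>cycles_on T. \<Sum>d\<in>T - {b}. F (c \<circ> w0) d)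
    = (\<Sum>c\<in>cycles_on T. \<Sum>d\<in>T - {b}. F (c \<circ> w0) d
        + of_bool (c \<circ> w0 \<in> cycles_on T \<and> (c \<circ> w0) b = d))"
    by (simp add: sum.distrib)
  also have "\<dots> = (\<Sum>c\<in>cycles_on T. \<Sum>d\<in>T - {b}. \<Sum>a\<in>T.
      of_bool (c \<circ> (w0 \<circ> exchange b d) \<in> cycles_on (T - {a})))"
  proof (intro sum.cong refl)
    fix c d assume c: "c \<in> cycles_on T" and d: "d \<in> T - {b}"
    have "c \<circ> (w0 \<circ> exchange b d) = c \<circ> w0 \<circ> exchange b d" by (simp add: comp_assoc)
    then show "F (c \<circ> w0) d + of_bool (c \<circ> w0 \<in> cycles_on T \<and> (c \<circ> w0) b = d)
      = (\<Sum>a\<in>T. of_bool (c \<circ> (w0 \<circ> exchange b d) \<in> cycles_on (T - {a})))"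
      unfolding F_def S using count_insert_point[OF fin p b _ _ v[OF c], of d] d
      by (simp only: DiffE singletonI singleton_iff Diff_iff simp_thms)
  qed
  also have "\<dots> = (\<Sum>d\<in>T - {b}. \<Sum>c\<in>cycles_on T. \<Sum>a\<in>T.
      of_bool (c \<circ> (w0 \<circ> exchange b d) \<in> cycles_on (T - {a})))"
    by (rule sum.swap)
  also have "\<dots> = (\<Sum>d\<in>T - {b}. 2 * fact (n - 2))"
  proof (rule sum.cong[OF refl])
    fix d assume d: "d \<in> T - {b}"
    have "w0 \<circ> exchange b d permutes T"
      using w0 b d by (intro permutes_compose permutes_swap_id) auto
    then show "(\<Sum>c\<in>cycles_on T. \<Sum>a\<in>T. of_bool (c \<circ> (w0 \<circ> exchange b d) \<in> cycles_on (T - {a})))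
        = (2 * fact (n - 2) :: nat)"
      using Suc.hyps(2)[of T "w0 \<circ> exchange b d"] cT fin odd[of d] d by simp
  qed
  also have "\<dots> = (n - 1) * (2 * fact (n - 2))"
    using fin b cT by simp
  also have "\<dots> = 2 * fact (card S - 2)"
  proof -
    obtain k where "n = k + 2" using Suc.hyps(1) by (metis add.commute le_Suc_ex)
    then show ?thesis by (simp flip: Suc.hyps(3))
  qed
  finally show ?case .
qed

section \<open>Counting factorizations by the missed point\<close>

text \<open>Both sides count the points lying in cycles of length \<open>i\<close>.\<close>
lemma count_cycle_type:
  assumes f: "f permutes S" and fin: "finite S"
  shows "i * count (cycle_type S f) i = (\<Sum>x\<in>S. of_bool (card (orbit f x) = i))"
proof -
  let ?A = "orbit f ` S"
  have perm: "permutation f" using f fin permutation_permutes by blast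
  have fib: "{x \<in> S. orbit f x = X} = X" "\<forall>x\<in>X. orbit f x = X" if "X \<in> ?A" for X
  proof -
    obtain y where y: "y \<in> S" "X = orbit f y" using \<open>X \<in> ?A\<close> by blast
    show *: "\<forall>x\<in>X. orbit f x = X"
      using orbit_cyclic_eq3[OF cyclic_on_orbit[OF f fin]] y(2) by blast
    have "x \<in> X" if "orbit f x = X" for x using permutation_self_in_orbit[OF perm, of x] that by simp
    then show "{x \<in> S. orbit f x = X} = X"
      using * permutes_orbit_subset[OF f y(1)] y(2) by blast
  qed
  have "(\<Sum>x\<in>S. of_bool (card (orbit f x) = i))
      = (\<Sum>X\<in>?A. \<Sum>x | x \<in> S \<and> orbit f x = X. of_bool (card (orbit f x) = i) :: nat)"
    by (rule sum.image_gen[OF fin])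
  also have "\<dots> = (\<Sum>X\<in>?A. if card X = i then i else 0)"
  proof (intro sum.cong refl)
    fix X assume "X \<in> ?A"
    note fib = fib[OF this]
    show "(\<Sum>x | x \<in> S \<and> orbit f x = X. of_bool (card (orbit f x) = i)) = (if card X = i then i else 0)"
      unfolding fib(1) using fib(2) by (simp del: sum_of_bool_eq cong: sum.cong)
  qed
  also have "\<dots> = i * card {X \<in> ?A. card X = i}"
    using fin by (simp add: sum.If_cases Int_def)
  also have "card {X \<in> ?A. card X = i} = count (cycle_type S f) i"
    using fin by (simp add: cycle_type_def count_image_mset vimage_def Int_def conj_commute)
  finally show ?thesis ..
qed

lemma cycle_type_comp_commute:
  assumes "f permutes S" "g permutes S" "finite S"
  shows "cycle_type S (f \<circ> g) = cycle_type S (g \<circ> f)"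
proof -
  have "f \<circ> g = f \<circ> (g \<circ> f) \<circ> inv f"
    by (simp add: comp_assoc permutes_inv_o[OF assms(1)])
  then show ?thesis using cycle_type_conj[OF assms(1,3) permutes_compose[OF assms(1,2)]] by simp
qed

lemma inv_in_cycles_on:
  assumes "finite S" "c \<in> cycles_on S"
  shows "inv c \<in> cycles_on S"
proof -
  note c = cycles_onD[OF assms(2)]
  have "permutation c" using c assms(1) permutation_permutes by blast
  then show ?thesis
    using assms(2) permutes_inv[OF c] orbit_inv_eq[of c] by (simp add: cycles_on_def cyclic_on_def)
qed

lemma bij_betw_inv_cycles_on:
  assumes "finite S"
  shows "bij_betw inv (cycles_on S) (cycles_on S)"
  using inv_in_cycles_on[OF assms] permutes_inv_inv cycles_onD
  by (intro bij_betw_byWitness[where f' = inv]) blast+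

lemma conj_swap_in_cycles_on:
  assumes "f \<in> cycles_on A"
  shows "exchange a b \<circ> f \<circ> exchange a b \<in> cycles_on (exchange a b ` A)"
proof -
  let ?t = "exchange a b"
  have "?t \<circ> f \<circ> ?t permutes ?t ` A"
  proof (rule bij_imp_permutes)
    have "bij_betw ?t (?t ` A) A" by (auto simp: bij_betw_def image_image)
    moreover have "bij_betw ?t A (?t ` A)" by (simp add: bij_betw_def)
    ultimately show "bij_betw (?t \<circ> f \<circ> ?t) (?t ` A) (?t ` A)"
      using permutes_imp_bij[OF cycles_onD[OF assms]] by (metis bij_betw_trans)
    show "(?t \<circ> f \<circ> ?t) x = x" if "x \<notin> ?t ` A" for x
      using that permutes_not_in[OF cycles_onD[OF assms], of "?t x"]
      by (simp add: in_transpose_image_iff)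
  qed
  moreover have "cyclic_on (?t \<circ> f \<circ> ?t) (?t ` A)"
    using assms by (intro cyclic_on_image[of f]) (auto simp: cycles_on_def)
  ultimately show ?thesis by (simp add: cycles_on_def)
qed

lemma bij_betw_conj_swap_cycles_on:
  "bij_betw (\<lambda>f. exchange a b \<circ> f \<circ> exchange a b) (cycles_on A) (cycles_on (exchange a b ` A))"
proof (rule bij_betw_byWitness[where f' = "\<lambda>f. exchange a b \<circ> f \<circ> exchange a b"])
  show "\<forall>f\<in>cycles_on A. exchange a b \<circ> (exchange a b \<circ> f \<circ> exchange a b) \<circ> exchange a b = f"
    by (simp add: fun_eq_iff)
  show "\<forall>f\<in>cycles_on (exchange a b ` A). exchange a b \<circ> (exchange a b \<circ> f \<circ> exchange a b) \<circ> exchange a b = f"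
    by (simp add: fun_eq_iff)
  show "(\<lambda>f. exchange a b \<circ> f \<circ> exchange a b) ` cycles_on A \<subseteq> cycles_on (exchange a b ` A)"
    by (rule image_subsetI, rule conj_swap_in_cycles_on)
  have "exchange a b ` exchange a b ` A = A" by (simp add: image_image)
  then show "(\<lambda>f. exchange a b \<circ> f \<circ> exchange a b) ` cycles_on (exchange a b ` A) \<subseteq> cycles_on A"
    using conj_swap_in_cycles_on[of _ "exchange a b ` A" a b] by auto
qed

text \<open>Summing over \<open>f\<close> and \<open>c\<close> instead of taking the cardinality of a set of pairs lets the
  sums below be interchanged and reindexed directly.\<close>
definition factorization_count :: "'a set \<Rightarrow> nat multiset \<Rightarrow> 'a \<Rightarrow> nat" where
  "factorization_count S lam a =
     (\<Sum>f\<in>cycles_on (S - {a}). \<Sum>c\<in>cycles_on S. of_bool (cycle_type S (f \<circ> c) = lam))"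

text \<open>Conjugation by the transposition of \<open>a\<close> and \<open>b\<close> carries the factorizations counted at
  \<open>a\<close> to those counted at \<open>b\<close> and preserves the cycle type of the product.\<close>
lemma factorization_count_indep:
  assumes fin: "finite S" and a: "a \<in> S" and b: "b \<in> S"
  shows "factorization_count S lam a = factorization_count S lam b"
proof -
  let ?t = "exchange a b" and ?k = "\<lambda>f. exchange a b \<circ> f \<circ> exchange a b"
  have t: "?t permutes S" using a b by (rule permutes_swap_id)
  have im: "?t ` (S - {a}) = S - {b}" "?t ` S = S"
    using a b by (auto simp: in_transpose_image_iff transpose_eq_iff transpose_def)
  have ct: "cycle_type S (?k f \<circ> ?k c) = cycle_type S (f \<circ> c)"
    if "f \<in> cycles_on (S - {a})" "c \<in> cycles_on S" for f c
  proof -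
    have "f permutes S" using permutes_subset[OF cycles_onD[OF that(1)]] by blast
    then have "f \<circ> c permutes S" using cycles_onD[OF that(2)] by (metis permutes_compose)
    moreover have "?k f \<circ> ?k c = ?t \<circ> (f \<circ> c) \<circ> inv ?t" by (simp add: fun_eq_iff)
    ultimately show ?thesis using cycle_type_conj[OF t fin] by simp
  qed
  have "factorization_count S lam b = (\<Sum>f\<in>cycles_on (S - {a}). \<Sum>c\<in>cycles_on S.
      of_bool (cycle_type S (?k f \<circ> c) = lam))"
    unfolding factorization_count_def
    using sum.reindex_bij_betw[OF bij_betw_conj_swap_cycles_on[of a b "S - {a}"], symmetric]
    unfolding im .
  also have "\<dots> = (\<Sum>f\<in>cycles_on (S - {a}). \<Sum>c\<in>cycles_on S.
      of_bool (cycle_type S (?k f \<circ> ?k c) = lam))"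
  proof (rule sum.cong[OF refl])
    fix f
    show "(\<Sum>c\<in>cycles_on S. of_bool (cycle_type S (?k f \<circ> c) = lam))
      = (\<Sum>c\<in>cycles_on S. of_bool (cycle_type S (?k f \<circ> ?k c) = lam) :: nat)"
      using sum.reindex_bij_betw[OF bij_betw_conj_swap_cycles_on[of a b S], symmetric]
      unfolding im .
  qed
  also have "\<dots> = factorization_count S lam a"
    unfolding factorization_count_def by (intro sum.cong refl) (simp add: ct)
  finally show ?thesis ..
qed

text \<open>Double counting of pairs of a full cycle and a cycle missing one point: on the left they
  are grouped by the permutation \<open>w\<close> of type \<open>lam\<close> that they produce, on the right by the missed
  point.  Solving \<open>c \<circ> w = f\<close> for \<open>w\<close> produces \<open>inv c \<circ> f\<close>; inversion permutes the full cycles, and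
  the order of the two factors does not matter for the cycle type.\<close>
lemma sum_factorization_count:
  assumes fin: "finite S"
  shows "(\<Sum>w | w permutes S \<and> cycle_type S w = lam. \<Sum>c\<in>cycles_on S. \<Sum>a\<in>S.
      of_bool (c \<circ> w \<in> cycles_on (S - {a}))) = (\<Sum>a\<in>S. factorization_count S lam a)"
proof -
  let ?W = "{w. w permutes S \<and> cycle_type S w = lam}"
  have finW: "finite ?W" by (rule finite_subset[OF _ finite_permutations[OF fin]]) auto
  have *: "(\<Sum>w\<in>?W. of_bool (c \<circ> w \<in> cycles_on (S - {a})))
      = (\<Sum>f\<in>cycles_on (S - {a}). of_bool (cycle_type S (inv c \<circ> f) = lam) :: nat)"
    if "c \<in> cycles_on S" for a c
  proof -
    note c = cycles_onD[OF that]
    have cc: "inv c \<circ> (c \<circ> w) = w" "c \<circ> (inv c \<circ> w) = w" for w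
      by (simp_all add: comp_assoc[symmetric] permutes_inv_o[OF c])
    have perm: "f permutes S" if "f \<in> cycles_on (S - {a})" for f
      using permutes_subset[OF cycles_onD[OF that]] by blast
    have "bij_betw ((\<circ>) c) {w \<in> ?W. c \<circ> w \<in> cycles_on (S - {a})}
        {f \<in> cycles_on (S - {a}). cycle_type S (inv c \<circ> f) = lam}"
      using perm permutes_compose[OF _ permutes_inv[OF c]]
      by (intro bij_betw_byWitness[where f' = "(\<circ>) (inv c)"]) (auto simp: cc)
    from bij_betw_same_card[OF this] show ?thesis
      using finW finite_cycles_on[of "S - {a}"] fin by (simp add: Int_def)
  qed
  have "(\<Sum>w\<in>?W. \<Sum>c\<in>cycles_on S. \<Sum>a\<in>S. of_bool (c \<circ> w \<in> cycles_on (S - {a})))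
      = (\<Sum>c\<in>cycles_on S. \<Sum>w\<in>?W. \<Sum>a\<in>S. of_bool (c \<circ> w \<in> cycles_on (S - {a})) :: nat)"
    by (rule sum.swap)
  also have "\<dots> = (\<Sum>c\<in>cycles_on S. \<Sum>a\<in>S. \<Sum>w\<in>?W. of_bool (c \<circ> w \<in> cycles_on (S - {a})))"
    by (intro sum.cong refl sum.swap)
  also have "\<dots> = (\<Sum>c\<in>cycles_on S. \<Sum>a\<in>S. \<Sum>f\<in>cycles_on (S - {a}).
      of_bool (cycle_type S (inv c \<circ> f) = lam))"
    by (intro sum.cong refl *)
  also have "\<dots> = (\<Sum>c\<in>cycles_on S. \<Sum>a\<in>S. \<Sum>f\<in>cycles_on (S - {a}).
      of_bool (cycle_type S (c \<circ> f) = lam))"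
    by (rule sum.reindex_bij_betw[OF bij_betw_inv_cycles_on[OF fin]])
  also have "\<dots> = (\<Sum>c\<in>cycles_on S. \<Sum>a\<in>S. \<Sum>f\<in>cycles_on (S - {a}).
      of_bool (cycle_type S (f \<circ> c) = lam))"
  proof (intro sum.cong refl)
    fix c a f assume c: "c \<in> cycles_on S" and f: "f \<in> cycles_on (S - {a})"
    have "f permutes S" using permutes_subset[OF cycles_onD[OF f]] by blast
    then show "of_bool (cycle_type S (c \<circ> f) = lam) = of_bool (cycle_type S (f \<circ> c) = lam)"
      using cycle_type_comp_commute[OF cycles_onD[OF c] _ fin] by simp
  qed
  also have "\<dots> = (\<Sum>a\<in>S. \<Sum>c\<in>cycles_on S. \<Sum>f\<in>cycles_on (S - {a}).
      of_bool (cycle_type S (f \<circ> c) = lam))"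
    by (rule sum.swap)
  also have "\<dots> = (\<Sum>a\<in>S. factorization_count S lam a)"
    unfolding factorization_count_def by (intro sum.cong refl sum.swap)
  finally show ?thesis .
qed

section \<open>Lowering a part of the partition\<close>

lemma lower_part_eq_iff:
  assumes "i \<in># T"
  shows "count lam (i + 1) \<noteq> 0 \<and> T = lower_part (i + 1) lam
    \<longleftrightarrow> add_mset (i + 1) (T - {#i#}) = lam"
proof -
  obtain U where T: "T = add_mset i U" using assms by (metis insert_DiffM)
  show ?thesis
    by (auto simp: T lower_part_def)
qed

lemma p_num_sum:
  "p_num n mu = (\<Sum>f\<in>cycles_on {1..n}. \<Sum>g\<in>cycles_on {1..n}. of_bool (cycle_type {1..n} (f \<circ> g) = mu))"
proof -
  let ?C = "cycles_on {1..n}"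
  have fin: "finite ?C" by (simp add: finite_cycles_on)
  have "p_num n mu = card {x \<in> ?C \<times> ?C. cycle_type {1..n} (fst x \<circ> snd x) = mu}"
    unfolding p_num_def full_cycles_def cycles_on_def
    by (intro arg_cong[of _ _ card]) auto
  also have "\<dots> = (\<Sum>x\<in>?C \<times> ?C. of_bool (cycle_type {1..n} (fst x \<circ> snd x) = mu))"
    using fin by (simp add: Int_def)
  finally show ?thesis by (simp add: sum.cartesian_product case_prod_unfold del: sum_of_bool_eq)
qed

text \<open>For \<open>mu = lower_part (i + 1) lam\<close> the weight \<open>i * count mu i\<close> is the number of ways to choose
  a point \<open>x\<close> in a cycle of length \<open>i\<close> of the product \<open>f \<circ> g\<close>.  Inserting \<open>n + 1\<close> after \<open>x\<close> lengthens
  this cycle and turns the type \<open>mu\<close> into \<open>lam\<close>.  The insertion can be absorbed into the second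
  factor, and \<open>(g, x)\<close> then runs over all full cycles on \<open>{1..n + 1}\<close> exactly once.\<close>
lemma sum_lower_parts:
  assumes n: "n \<ge> 1"
  shows "(\<Sum>i | i > 0 \<and> count lam (i + 1) \<noteq> 0.
      i * count (lower_part (i + 1) lam) i * p_num n (lower_part (i + 1) lam))
    = factorization_count {1..n + 1} lam (n + 1)"
proof -
  let ?I = "{i. i > 0 \<and> count lam (i + 1) \<noteq> 0}" and ?C = "cycles_on {1..n}"
  define K where "K = {1..n}"
  have K: "finite K" "n + 1 \<notin> K" "K \<noteq> {}" and KN: "{1..n + 1} = insert (n + 1) K"
    and KD: "insert (n + 1) K - {n + 1} = K"
    using n by (auto simp: K_def)
  have "?I \<subseteq> (\<lambda>j. j - 1) ` set_mset lam" by force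
  then have finI: "finite ?I" by (rule finite_subset) simp
  \<comment> \<open>for given h and x only i = card (orbit h x) can contribute\<close>
  have inner: "(\<Sum>i\<in>?I. \<Sum>x\<in>K. of_bool (cycle_type K h = lower_part (i + 1) lam \<and> card (orbit h x) = i))
      = (\<Sum>x\<in>K. of_bool (cycle_type (insert (n + 1) K) (h \<circ> exchange x (n + 1)) = lam) :: nat)"
    if h: "h permutes K" for h
  proof (subst sum.swap, intro sum.cong refl)
    fix x assume x: "x \<in> K"
    let ?j = "card (orbit h x)"
    have "finite (orbit h x)"
      using permutes_orbit_subset[OF h x] K(1) by (rule finite_subset)
    then have j: "?j > 0" using orbit_nonempty[of h x] by (simp add: card_gt_0_iff)
    have "(\<Sum>i\<in>?I. of_bool (cycle_type K h = lower_part (i + 1) lam \<and> ?j = i))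
        = (\<Sum>i\<in>?I. if ?j = i then of_bool (cycle_type K h = lower_part (?j + 1) lam) else (0::nat))"
      by (intro sum.cong) auto
    also have "\<dots> = of_bool (count lam (?j + 1) \<noteq> 0 \<and> cycle_type K h = lower_part (?j + 1) lam)"
      using finI j by (simp add: sum.delta')
    also have "\<dots> = of_bool (cycle_type (insert (n + 1) K) (h \<circ> exchange x (n + 1)) = lam)"
      unfolding lower_part_eq_iff[OF card_orbit_in_cycle_type[OF K(1) x]]
        cycle_type_insert_point[OF h K(1,2) x] ..
    finally show "(\<Sum>i\<in>?I. of_bool (cycle_type K h = lower_part (i + 1) lam \<and> ?j = i))
      = (of_bool (cycle_type (insert (n + 1) K) (h \<circ> exchange x (n + 1)) = lam) :: nat)" .
  qed
  have "(\<Sum>i\<in>?I. i * count (lower_part (i + 1) lam) i * p_num n (lower_part (i + 1) lam))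
    = (\<Sum>i\<in>?I. \<Sum>f\<in>cycles_on K. \<Sum>g\<in>cycles_on K. \<Sum>x\<in>K.
        of_bool (cycle_type K (f \<circ> g) = lower_part (i + 1) lam \<and> card (orbit (f \<circ> g) x) = i))"
  proof (intro sum.cong refl)
    fix i
    let ?mu = "lower_part (i + 1) lam"
    have "i * count ?mu i * p_num n ?mu = (\<Sum>f\<in>cycles_on K. \<Sum>g\<in>cycles_on K.
        i * count ?mu i * of_bool (cycle_type K (f \<circ> g) = ?mu))"
      unfolding p_num_sum K_def by (simp only: sum_distrib_left)
    also have "\<dots> = (\<Sum>f\<in>cycles_on K. \<Sum>g\<in>cycles_on K. \<Sum>x\<in>K.
        of_bool (cycle_type K (f \<circ> g) = ?mu \<and> card (orbit (f \<circ> g) x) = i))"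
    proof (intro sum.cong refl)
      fix f g assume f: "f \<in> cycles_on K" and g: "g \<in> cycles_on K"
      have "f \<circ> g permutes K" using permutes_compose[OF cycles_onD[OF g] cycles_onD[OF f]] .
      from count_cycle_type[OF this K(1), of i]
      show "i * count ?mu i * of_bool (cycle_type K (f \<circ> g) = ?mu) = (\<Sum>x\<in>K.
        of_bool (cycle_type K (f \<circ> g) = ?mu \<and> card (orbit (f \<circ> g) x) = i))"
        by (cases "cycle_type K (f \<circ> g) = ?mu") (simp_all del: sum_of_bool_eq)
    qed
    finally show "i * count ?mu i * p_num n ?mu = (\<Sum>f\<in>cycles_on K. \<Sum>g\<in>cycles_on K. \<Sum>x\<in>K.
        of_bool (cycle_type K (f \<circ> g) = ?mu \<and> card (orbit (f \<circ> g) x) = i))" .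
  qed
  also have "\<dots> = (\<Sum>f\<in>cycles_on K. \<Sum>i\<in>?I. \<Sum>g\<in>cycles_on K. \<Sum>x\<in>K.
        of_bool (cycle_type K (f \<circ> g) = lower_part (i + 1) lam \<and> card (orbit (f \<circ> g) x) = i))"
    by (rule sum.swap)
  also have "\<dots> = (\<Sum>f\<in>cycles_on K. \<Sum>g\<in>cycles_on K. \<Sum>i\<in>?I. \<Sum>x\<in>K.
        of_bool (cycle_type K (f \<circ> g) = lower_part (i + 1) lam \<and> card (orbit (f \<circ> g) x) = i))"
    by (intro sum.cong refl sum.swap)
  also have "\<dots> = (\<Sum>f\<in>cycles_on K. \<Sum>g\<in>cycles_on K. \<Sum>x\<in>K.
        of_bool (cycle_type (insert (n + 1) K) (f \<circ> g \<circ> exchange x (n + 1)) = lam))"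
    using permutes_compose[OF cycles_onD cycles_onD] by (intro sum.cong refl inner) blast
  also have "\<dots> = factorization_count {1..n + 1} lam (n + 1)"
    unfolding factorization_count_def KN KD sum_cycles_on_insert[OF K] comp_assoc ..
  finally show ?thesis .
qed

theorem theorem1p1:
  fixes n m :: nat and lam :: "nat multiset"
  assumes "n \<ge> 1" and "m \<ge> 1" and "even n \<longleftrightarrow> even m"
    and "partition_of (n + 1) lam" and "size lam = m"
  shows "(real n + 1) / 2 *
      (\<Sum>i | i > 0 \<and> count lam (i + 1) \<noteq> 0.
         let mu = lower_part (i + 1) lam in real i * real (count mu i) * real (p_num n mu))
    = fact (n - 1) * real (z_num lam)"
proof -
  let ?S = "{1..n + 1}" and ?P = "factorization_count {1..n + 1} lam (n + 1)"
  let ?W = "{w. w permutes ?S \<and> cycle_type ?S w = lam}"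
  have z: "z_num lam = card ?W" using assms(4) by (simp add: z_num_def partition_of_def)
  have "(n + 1) * ?P = (\<Sum>a\<in>?S. factorization_count ?S lam a)"
  proof -
    have "(\<Sum>a\<in>?S. factorization_count ?S lam a) = (\<Sum>a\<in>?S. ?P)"
      by (intro sum.cong refl factorization_count_indep) auto
    then show ?thesis by simp
  qed
  also have "\<dots> = (\<Sum>w\<in>?W. \<Sum>c\<in>cycles_on ?S. \<Sum>a\<in>?S. of_bool (c \<circ> w \<in> cycles_on (?S - {a})))"
    by (rule sum_factorization_count[symmetric]) simp
  also have "\<dots> = (\<Sum>w\<in>?W. 2 * fact (card ?S - 2))"
  proof (rule sum.cong[OF refl])
    fix w assume w: "w \<in> ?W"
    then have "\<not> evenperm w" using evenperm_iff_cycle_type[of ?S w] assms(3,5) by simp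
    then show "(\<Sum>c\<in>cycles_on ?S. \<Sum>a\<in>?S. of_bool (c \<circ> w \<in> cycles_on (?S - {a})))
        = (2 * fact (card ?S - 2) :: nat)"
      using w assms(1) by (intro count_factorizations_of_odd) auto
  qed
  also have "\<dots> = 2 * (fact (n - 1) * z_num lam)" by (simp add: z)
  finally have "real ((n + 1) * ?P) = real (2 * (fact (n - 1) * z_num lam))" by (rule arg_cong)
  then have "(real n + 1) * real ?P = 2 * (fact (n - 1) * real (z_num lam))"
    by (simp add: algebra_simps)
  moreover have "(\<Sum>i | i > 0 \<and> count lam (i + 1) \<noteq> 0.
         let mu = lower_part (i + 1) lam in real i * real (count mu i) * real (p_num n mu)) = real ?P"
    unfolding sum_lower_parts[OF assms(1), symmetric] by (simp add: Let_def)
  ultimately show ?thesis by simp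
qed

end
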